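(* Let $M=\prod_{i=1}^k p_i$, where $p_1,\dots,p_k$ are pairwise different primes. Assume that $p_{j+1}>\prod_{i=1}^{j}p_i$ for $j=1,2,\ldots,k-1$. Then Fuglede's conjecture holds in $\mathbb{Z}_M$; that is, a non-empty subset of $\mathbb{Z}_M$ is spectral if and only if it tiles $\mathbb{Z}_M$.
   Context: $\mathbb{Z}_M$ denotes the cyclic group of order $M$. A non-empty set $A\subseteq\mathbb{Z}_M$ is spectral if there is a set $\Lambda\subseteq\mathbb{Z}_M$ with $|\Lambda|=|A|$ such that $\sum_{a\in A}e^{2\pi i(\lambda-\lambda')a/M}=0$ for all distinct $\lambda,\lambda'\in\Lambda$. A set $A\subseteq\mathbb{Z}_M$ tiles $\mathbb{Z}_M$ if there is $B\subseteq\mathbb{Z}_M$ such that every element of $\mathbb{Z}_M$ has a unique representation as $a+b$ with $a\in A$, $b\in B$. *)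

theory Defs
  imports Complex_Main "HOL-Computational_Algebra.Primes" "HOL-Algebra.Elementary_Groups"
begin

text \<open>The cyclic group of order \<open>M > 0\<close> is \<^term>\<open>integer_mod_group M\<close>, whose carrier
  consists of the integers \<open>0, \<dots>, M - 1\<close>.
  The difference \<open>l - l'\<close> below is taken in the integers; this is harmless because
  the exponential only depends on \<open>(l - l') * a\<close> modulo \<open>M\<close>.\<close>

definition spectral :: "nat \<Rightarrow> int set \<Rightarrow> bool" where
  "spectral M A \<longleftrightarrow> A \<noteq> {} \<and> A \<subseteq> carrier (integer_mod_group M) \<and>
     (\<exists>\<Lambda> \<subseteq> carrier (integer_mod_group M). card \<Lambda> = card A \<and>
        (\<forall>l\<in>\<Lambda>. \<forall>l'\<in>\<Lambda>. l \<noteq> l' \<longrightarrow>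
           (\<Sum>a\<in>A. exp (2 * complex_of_real pi * \<i> * of_int (l - l') * of_int a / of_nat M)) = 0))"

definition tiles :: "nat \<Rightarrow> int set \<Rightarrow> bool" where
  "tiles M A \<longleftrightarrow> A \<subseteq> carrier (integer_mod_group M) \<and>
     (\<exists>B \<subseteq> carrier (integer_mod_group M).
        \<forall>x \<in> carrier (integer_mod_group M).
          \<exists>!ab. ab \<in> A \<times> B \<and> x = fst ab \<otimes>\<^bsub>integer_mod_group M\<^esub> snd ab)"

end

(* Both properties are equivalent to: N = card A divides M and the elements of A are pairwise
   incongruent modulo N. For tilings A + B this only needs M squarefree: then card B is coprime
   to N, so dilating A by card B preserves the tiling, and incongruence of the elements
   (card B) * a modulo M gives the claim.
   For spectral sets one inducts on the number of primes. Let p be the largest one, M = m * p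
   with m < p. A character sum over A of order divisible by p vanishes only if the sums over the
   fibres of A modulo p of its component modulo m all agree. If card A <= m, some fibre is empty,
   so A is spectral modulo m. Otherwise A and its spectrum L are equidistributed modulo p,
   and as m < p, in some fibre of L every element is congruent modulo m to an element of another
   fibre. This fibre is then a common spectrum modulo m for all fibres of A. *)
theory Submission
  imports Defs "HOL-Computational_Algebra.Polynomial_Factorial"
    "HOL-Computational_Algebra.Squarefree" "HOL-Number_Theory.Cong"
begin

section \<open>Integer polynomials at conjugate roots of unity\<close>

lemma prime_dvd_power_add_diff:
  fixes u v :: "'a::comm_ring_1"
  assumes "prime (q::nat)"
  shows "of_nat q dvd (u + v) ^ q - u ^ q - v ^ q"
proof -
  have q: "q > 0" using assms prime_gt_0_nat by blast
  have "(u + v) ^ q = (\<Sum>k\<le>q. of_nat (q choose k) * u ^ k * v ^ (q - k))"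
    by (rule binomial_ring)
  also have "{..q} = insert 0 (insert q {0<..<q})" using q by auto
  also have "(\<Sum>k\<in>\<dots>. of_nat (q choose k) * u ^ k * v ^ (q - k))
     = u ^ q + v ^ q + (\<Sum>k\<in>{0<..<q}. of_nat (q choose k) * u ^ k * v ^ (q - k))"
    using q by (simp add: algebra_simps)
  finally have "(u + v) ^ q - u ^ q - v ^ q =
      (\<Sum>k\<in>{0<..<q}. of_nat (q choose k) * u ^ k * v ^ (q - k))" by simp
  moreover have "of_nat q dvd (of_nat (q choose k) * u ^ k * v ^ (q - k) :: 'a)"
    if "k \<in> {0<..<q}" for k
  proof -
    have "q dvd q choose k" using that assms by (intro dvd_choose_prime) auto
    then have "of_nat q dvd (of_nat (q choose k) :: 'a)" by (auto elim!: dvdE)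
    then show ?thesis by (simp add: dvd_mult2)
  qed
  ultimately show ?thesis by (auto intro!: dvd_sum)
qed

text \<open>Fermat's little theorem, by induction from the binomial congruence.\<close>

lemma prime_dvd_int_power_diff:
  assumes "prime (q::nat)"
  shows "int q dvd a ^ q - a"
proof -
  have q: "q > 0" using assms prime_gt_0_nat by blast
  have nat: "int q dvd int n ^ q - int n" for n
  proof (induction n)
    case (Suc n)
    have "int q dvd ((int n + 1) ^ q - int n ^ q - 1 ^ q) + (int n ^ q - int n)"
      using prime_dvd_power_add_diff[OF assms, of "int n" 1] Suc by (intro dvd_add) simp_all
    then show ?case by (simp add: algebra_simps)
  qed (use q in \<open>simp add: zero_power\<close>)
  \<comment> \<open>Passing to the least residue modulo \<open>q\<close> reduces negative
    \<open>a\<close> to the case of natural numbers.\<close>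
  define b where "b = nat (a mod int q)"
  have b: "int b = a mod int q" using q by (simp add: b_def)
  have "[int b ^ q = int b] (mod int q)"
    using nat by (simp add: cong_iff_dvd_diff)
  then have "[a ^ q = a] (mod int q)"
    unfolding b by (simp add: cong_def power_mod)
  then show ?thesis by (simp add: cong_iff_dvd_diff)
qed

text \<open>Modulo \<open>q\<close> the \<open>q\<close>-th power map is additive, fixes constants
  by Fermat and sends \<open>X\<close> to \<open>X^q\<close>. The induction peels off the constant
  term in Horner form.\<close>

lemma prime_dvd_poly_power_diff_pcompose:
  fixes h :: "int poly"
  assumes "prime (q::nat)"
  shows "of_nat q dvd h ^ q - pcompose h (monom 1 q)"
proof (induction h)
  case 0
  then show ?case using assms prime_gt_0_nat[of q] by (simp add: zero_power)
next
  case (pCons a h)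
  let ?X = "monom 1 1 :: int poly"
  have e: "pCons a h = [:a:] + ?X * h"
    by (simp add: monom_altdef)
  have X: "pcompose ?X (monom 1 q) = ?X ^ q"
    by (simp add: monom_altdef pcompose_pCons)
  have 1: "of_nat q dvd ([:a:] + ?X * h) ^ q - [:a:] ^ q - (?X * h) ^ q"
    by (rule prime_dvd_power_add_diff[OF assms])
  have "of_nat q = [:int q:]" by (simp add: of_nat_poly)
  moreover have "[:a:] ^ q - [:a:] = [:a ^ q - a:]" by (simp add: poly_const_pow)
  ultimately have 2: "of_nat q dvd [:a:] ^ q - [:a:]"
    using prime_dvd_int_power_diff[OF assms, of a] by simp
  have 3: "of_nat q dvd ?X ^ q * (h ^ q - pcompose h (monom 1 q))"
    using pCons by simp
  have "(pCons a h) ^ q - pcompose (pCons a h) (monom 1 q) =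
     (([:a:] + ?X * h) ^ q - [:a:] ^ q - (?X * h) ^ q) + ([:a:] ^ q - [:a:])
       + ?X ^ q * (h ^ q - pcompose h (monom 1 q))"
    unfolding e pcompose_add pcompose_mult
    unfolding X by (simp add: algebra_simps power_mult_distrib)
  then show ?case using 1 2 3 by (metis dvd_add)
qed

section \<open>Evaluation at a complex number and minimal integer polynomials\<close>

definition zeval :: "int poly \<Rightarrow> complex \<Rightarrow> complex" where
  "zeval f w = poly (map_poly of_int f) w"

lemma zeval_0 [simp]: "zeval 0 w = 0"
  by (simp add: zeval_def)

lemma zeval_pCons [simp]: "zeval (pCons a f) w = of_int a + w * zeval f w"
  by (simp add: zeval_def map_poly_pCons)

lemma zeval_1 [simp]: "zeval 1 w = 1"
  by (simp add: one_pCons)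

lemma zeval_add [simp]: "zeval (f + g) w = zeval f w + zeval g w"
  by (induction f g rule: poly_induct2) (simp_all add: algebra_simps)

lemma zeval_smult [simp]: "zeval (smult c f) w = of_int c * zeval f w"
  by (induction f) (simp_all add: algebra_simps)

lemma zeval_diff [simp]: "zeval (f - g) w = zeval f w - zeval g w"
  using zeval_add[of "f - g" g w] by simp

lemma zeval_mult [simp]: "zeval (f * g) w = zeval f w * zeval g w"
  by (induction f) (simp_all add: algebra_simps)

lemma zeval_sum: "zeval (sum f A) w = (\<Sum>a\<in>A. zeval (f a) w)"
  by (induction A rule: infinite_finite_induct) simp_all

lemma zeval_monom [simp]: "zeval (monom c n) w = of_int c * w ^ n"
  by (induction n) (simp_all add: monom_0 monom_Suc)

lemma zeval_pcompose_monom: "zeval (pcompose f (monom 1 q)) w = zeval f (w ^ q)"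
  by (induction f) (simp_all add: pcompose_pCons)

text \<open>Gauss's lemma: taking primitive parts preserves divisibility, and a nonzero constant
  contributes only its sign to the primitive part.\<close>

lemma content_1_dvd_smultD:
  fixes g F :: "int poly"
  assumes "content g = 1" "g dvd smult c F" "c \<noteq> 0"
  shows "g dvd F"
proof -
  have "primitive_part g dvd primitive_part (smult c F)"
    using assms(2) by (rule primitive_part_dvd_primitive_partI)
  then have "g dvd smult (unit_factor c) (primitive_part F)"
    using assms by (simp add: primitive_part_prim primitive_part_smult)
  also have "\<dots> dvd F"
  proof -
    have "primitive_part F dvd F"
      by (metis content_times_primitive_part dvd_refl dvd_smult)
    moreover have "unit_factor c = 1 \<or> unit_factor c = - 1"
      using assms(3) by (simp add: sgn_if)
    ultimately show ?thesis by auto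
  qed
  finally show ?thesis .
qed

text \<open>\<open>g\<close> is the primitive part of a nonzero polynomial of least degree vanishing
  at \<open>w\<close>. Pseudo-division stays over the integers, and Gauss's lemma removes the
  constant that it introduces.\<close>

lemma min_int_poly_dvd:
  assumes "F0 \<noteq> 0" "zeval F0 w = 0"
  obtains g where "g \<noteq> 0" "zeval g w = 0" "\<And>F. zeval F w = 0 \<Longrightarrow> g dvd F"
proof -
  define P where "P f \<longleftrightarrow> f \<noteq> 0 \<and> zeval f w = 0" for f
  obtain f where f: "P f" "\<And>f'. P f' \<Longrightarrow> degree f \<le> degree f'"
    using ex_has_least_nat[of P F0 degree] assms by (auto simp: P_def)
  define g where "g = primitive_part f"
  have fg: "f = smult (content f) g" by (simp add: g_def)
  have g: "g \<noteq> 0" using f(1) by (simp add: P_def g_def)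
  have "zeval f w = of_int (content f) * zeval g w"
    by (subst fg) (rule zeval_smult)
  then have gw: "zeval g w = 0"
    using f(1) by (auto simp: P_def)
  show ?thesis
  proof (rule that[OF g gw])
    fix F assume F: "zeval F w = 0"
    obtain a q where a: "a \<noteq> 0" and eq: "smult a F = g * q + pseudo_mod F g"
      using pseudo_mod(1)[OF g, of F] by blast
    have "zeval (smult a F) w = zeval (g * q + pseudo_mod F g) w" using eq by simp
    then have "zeval (pseudo_mod F g) w = 0" using F gw by simp
    then have "pseudo_mod F g = 0"
      using pseudo_mod(2)[OF g, of F] f(2)[of "pseudo_mod F g"]
      by (metis P_def degree_primitive_part g_def not_less)
    then have "g dvd smult a F" using eq by simp
    then show "g dvd F" using a g by (intro content_1_dvd_smultD[of g a F]) (auto simp: g_def)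
  qed
qed

text \<open>Modulo \<open>q\<close> the polynomial \<open>g\<close> keeps its positive degree, so it
  is not a unit there. Instead of forming the quotient ring, the proof repeatedly moves the leading
  term of \<open>a\<close>, found to be divisible by \<open>q\<close>, into
  \<open>b\<close>.\<close>

lemma lead_coeff_mod_prime_not_unit:
  fixes g :: "int poly"
  assumes "prime q" "\<not> q dvd lead_coeff g" "degree g > 0"
  shows "1 \<noteq> g * a + smult q b"
proof
  assume "1 = g * a + smult q b"
  then show False
  proof (induction "degree a" arbitrary: a b rule: less_induct)
    case less
    have q: "\<not> is_unit q" using assms(1) not_prime_unit by blast
    \<comment> \<open>The top term of \<open>g * a\<close> has positive degree, where the constant 1
      has coefficient zero.\<close>
    have c: "coeff (g * a) (degree g + degree a) + q * coeff b (degree g + degree a) = 0"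
      using assms(3) arg_cong[OF less.prems, of "\<lambda>f. coeff f (degree g + degree a)"] by simp
    then have "q dvd lead_coeff g * lead_coeff a"
      by (metis coeff_mult_degree_sum dvd_triv_left dvd_add_left_iff dvd_0_right)
    then obtain r where r: "lead_coeff a = q * r"
      using assms by (auto simp: prime_dvd_mult_iff elim: dvdE)
    define a' where "a' = a - monom (lead_coeff a) (degree a)"
    define b' where "b' = b + g * monom r (degree a)"
    have e: "1 = g * a' + smult q b'"
      using less.prems by (simp add: a'_def b'_def r algebra_simps smult_add_right)
        (simp add: mult_smult_right[symmetric] smult_monom del: mult_smult_right)
    show False
    proof (cases "degree a = 0")
      case True
      then have "a' = 0" by (metis a'_def degree_0_id diff_self monom_0 of_nat_0 lead_coeff_pCons(2) degree_eq_zeroE coeff_pCons_0 )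
      then have "1 = smult q b'" using e by simp
      then have "coeff 1 0 = q * coeff b' 0" by (metis coeff_smult)
      then show False using q by (simp add: dvd_def)
    next
      case False
      have "degree a' < degree a"
        using False by (metis a'_def coeff_diff coeff_monom degree_diff_le degree_monom_le diff_self le_neq_implies_less leading_coeff_0_iff degree_0 less_nat_zero_code neq0_conv)
      then show False using less.hyps e by blast
    qed
  qed
qed

text \<open>With \<open>X\<^sup>M - 1 = g h\<close>, if \<open>w\<^sup>q\<close> were a root of \<open>h\<close> then \<open>g\<close> would divide
  \<open>h(X\<^sup>q) \<equiv> h(X)\<^sup>q\<close> modulo \<open>q\<close>, contradicting the separability of \<open>X\<^sup>M - 1\<close> modulo \<open>q\<close>.
  Separability enters in the form that \<open>M\<close> lies in the ideal generated by \<open>g\<close> and \<open>h\<close>.\<close>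

lemma zeval_root_of_unity_power_prime:
  assumes w: "w ^ M = 1" "M > 0" and q: "prime q" "\<not> q dvd M" and F: "zeval F w = 0"
  shows "zeval F (w ^ q) = 0"
proof -
  define U :: "int poly" where "U = monom 1 M - 1"
  have "zeval U w = 0" by (simp add: U_def w)
  moreover have "coeff U M = 1" using w(2) by (simp add: U_def)
  then have "U \<noteq> 0" by auto
  ultimately obtain g where g: "g \<noteq> 0" "zeval g w = 0" "\<And>F. zeval F w = 0 \<Longrightarrow> g dvd F"
    using min_int_poly_dvd by blast
  obtain h where h: "U = g * h" using g(3)[OF \<open>zeval U w = 0\<close>] by (elim dvdE)
  have "degree (monom 1 M + (- 1) :: int poly) = degree (monom 1 M :: int poly)"
    using w(2) by (intro degree_add_eq_left) (simp add: degree_monom_eq)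
  then have degU: "degree U = M" by (simp add: U_def degree_monom_eq)
  \<comment> \<open>\<open>U\<close> is monic, so \<open>g\<close> has a unit as leading coefficient
    and keeps its degree modulo \<open>q\<close>.\<close>
  have "lead_coeff g * lead_coeff h = 1"
    using \<open>coeff U M = 1\<close> h degU by (metis lead_coeff_mult)
  then have lg: "is_unit (lead_coeff g)" by (metis dvd_triv_left)
  have dg: "degree g > 0"
  proof (rule ccontr)
    assume "\<not> degree g > 0"
    then obtain c where "g = [:c:]" by (auto elim: degree_eq_zeroE)
    then show False using g by auto
  qed
  have "zeval g (w ^ q) = 0"
  proof (rule ccontr)
    assume gq: "zeval g (w ^ q) \<noteq> 0"
    have "zeval U (w ^ q) = 0" by (simp add: U_def w flip: power_mult) (metis mult.commute power_mult power_one w(1))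
    then have "zeval h (w ^ q) = 0" using gq h by simp
    then have "g dvd pcompose h (monom 1 q)" by (intro g(3)) (simp add: zeval_pcompose_monom)
    then obtain k where k: "pcompose h (monom 1 q) = g * k" by (elim dvdE)
    obtain K where "h ^ q - pcompose h (monom 1 q) = of_nat q * K"
      using prime_dvd_poly_power_diff_pcompose[OF q(1), of h] by (elim dvdE)
    then have hq: "h ^ q = g * k + of_nat q * K" using k by (simp add: algebra_simps)
    let ?X = "monom 1 1 :: int poly"
    have "pderiv U = monom (int M) (M - 1)" by (simp add: U_def pderiv_diff pderiv_monom)
    then have d: "pderiv g * h + g * pderiv h = monom (int M) (M - 1)"
      using h by (simp add: pderiv_mult algebra_simps)
    \<comment> \<open>The identity \<open>X * U' - M * U = M\<close>; expanding \<open>U'\<close> by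
      the product rule puts \<open>M\<close> into the ideal generated by \<open>g\<close> and
      \<open>h\<close>.\<close>
    have "?X * monom (int M) (M - 1) - of_nat M * U = of_nat M"
      using w(2) by (simp add: U_def mult_monom algebra_simps of_nat_poly smult_monom)
    then have "of_nat M = ?X * (pderiv g * h + g * pderiv h) - of_nat M * (g * h)"
      by (simp only: d h)
    then have M: "of_nat M - h * (?X * pderiv g) = g * (?X * pderiv h - of_nat M * h)"
      by (simp add: algebra_simps)
    define u where "u = ?X * pderiv g"
    \<comment> \<open>Taking \<open>q\<close>-th powers brings in \<open>h ^ q\<close>, which lies
      in the ideal generated by \<open>g\<close> and \<open>q\<close>; hence so does
      \<open>M ^ q\<close>.\<close>
    have "of_nat M - h * u dvd of_nat M ^ q - (h * u) ^ q"
      by (metis power_diff_sumr2 dvd_triv_left)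
    then have "g dvd of_nat M ^ q - (h * u) ^ q"
      using M unfolding u_def by (metis dvd_triv_left dvd_trans)
    then obtain v where "of_nat M ^ q - (h * u) ^ q = g * v" by (elim dvdE)
    then have Mq: "of_nat M ^ q = g * (v + k * u ^ q) + of_nat q * (K * u ^ q)"
      using hq by (simp add: power_mult_distrib algebra_simps)
    \<comment> \<open>Bezout replaces \<open>M ^ q\<close> by 1, which would make \<open>g\<close> a
      unit modulo \<open>q\<close>.\<close>
    have "coprime (int M ^ q) (int q)"
      using prime_imp_coprime[OF q] by (simp add: coprime_commute)
    then obtain s t where "s * int M ^ q + t * int q = 1" using bezout_int by (metis coprime_iff_gcd_eq_1)
    then have "[:1:] = smult s ([:int M:] ^ q) + smult (int q) [:t:]"
      by (simp add: poly_const_pow algebra_simps)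
    then have "1 = smult s (of_nat M ^ q) + smult (int q) [:t:]"
      by (simp add: one_pCons of_nat_poly)
    also have "\<dots> = g * smult s (v + k * u ^ q) + smult (int q) ([:t:] + smult s (K * u ^ q))"
      unfolding Mq by (simp add: of_nat_poly smult_add_right algebra_simps)
    finally have e: "1 = g * smult s (v + k * u ^ q) + smult (int q) ([:t:] + smult s (K * u ^ q))" .
    have nd: "\<not> int q dvd lead_coeff g"
      using lg q(1) by (meson dvd_trans not_prime_unit prime_nat_int_transfer)
    have pq: "prime (int q)" using q(1) by simp
    show False
      by (rule notE[OF lead_coeff_mod_prime_not_unit[OF pq nd dg] e])
  qed
  then show ?thesis using g(3)[OF F] by (auto elim!: dvdE)
qed

text \<open>One prime factor of \<open>t\<close> is treated at a time; raising to a prime power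
  keeps \<open>w\<close> an \<open>M\<close>-th root of unity.\<close>

lemma zeval_root_of_unity_power_coprime:
  assumes "w ^ M = 1" "M > 0" "coprime t M" "zeval F w = 0" "t > 0"
  shows "zeval F (w ^ t) = 0"
  using assms
proof (induction t arbitrary: w rule: prime_divisors_induct)
  case (factor p t)
  have "\<not> p dvd M"
    using factor.prems factor.hyps
    by (metis coprime_common_divisor dvd_triv_left not_prime_unit)
  then have "zeval F (w ^ p) = 0"
    using factor.prems factor.hyps by (intro zeval_root_of_unity_power_prime[of w M]) auto
  moreover have "(w ^ p) ^ M = 1"
    using factor.prems by (metis mult.commute power_mult power_one)
  ultimately have "zeval F ((w ^ p) ^ t) = 0"
    using factor.prems by (intro factor.IH) auto
  then show ?case by (simp add: power_mult)
qed auto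

section \<open>Character sums\<close>

definition unity :: "nat \<Rightarrow> int \<Rightarrow> complex" where
  "unity m x = cis (2 * pi * of_int x / of_nat m)"

lemma unity_0 [simp]: "unity m 0 = 1"
  by (simp add: unity_def)

lemma unity_add: "unity m (x + y) = unity m x * unity m y"
  by (simp add: unity_def cis_mult algebra_simps add_divide_distrib)

lemma cnj_unity: "cnj (unity m x) = unity m (- x)"
  by (simp add: unity_def cis_cnj)

lemma unity_power: "unity m x ^ n = unity m (x * int n)"
  by (induction n) (simp_all add: unity_add algebra_simps)

lemma unity_eq_1_iff:
  assumes "m > 0"
  shows "unity m x = 1 \<longleftrightarrow> int m dvd x"
proof -
  have "cis y = 1 \<longleftrightarrow> cos y = 1" for y
    by (auto simp: complex_eq_iff cos_one_sin_zero)
  then have "unity m x = 1 \<longleftrightarrow> (\<exists>n::int. 2 * pi * real_of_int x / real m = of_int n * 2 * pi)"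
    by (simp add: unity_def cos_one_2pi_int)
  also have "\<dots> \<longleftrightarrow> (\<exists>n::int. real_of_int x = real_of_int (int m * n))"
    using assms by (simp add: field_simps)
  also have "\<dots> \<longleftrightarrow> int m dvd x"
    unfolding of_int_eq_iff dvd_def ..
  finally show ?thesis .
qed

lemma unity_cong:
  assumes "m > 0" "[x = y] (mod int m)"
  shows "unity m x = unity m y"
proof -
  have "unity m (x - y) = 1"
    using assms by (simp add: unity_eq_1_iff cong_iff_dvd_diff)
  then show ?thesis using unity_add[of m "x - y" y] by simp
qed

lemma unity_mult_cancel: "k > 0 \<Longrightarrow> unity (k * m) (int k * x) = unity m x"
  by (cases "m = 0") (simp_all add: unity_def field_simps)

lemma sum_unity:
  assumes "m > 0"
  shows "(\<Sum>t<m. unity m (x * int t)) = (if int m dvd x then of_nat m else 0)"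
proof (cases "int m dvd x")
  case True
  then have "unity m (x * int t) = 1" for t
    using assms by (simp add: unity_eq_1_iff)
  then show ?thesis using True by simp
next
  case False
  then have "unity m x \<noteq> 1" using assms by (simp add: unity_eq_1_iff)
  moreover have "unity m x ^ m = 1"
    using assms by (simp add: unity_power unity_eq_1_iff)
  ultimately have "(\<Sum>t<m. unity m x ^ t) = 0" by (simp add: sum_gp_strict)
  then show ?thesis using False by (simp add: unity_power)
qed

text \<open>The sum is an integer polynomial evaluated at \<open>unity M l\<close>, and the factor
  \<open>t\<close> replaces this root of unity by its \<open>t\<close>-th power, a
  conjugate.\<close>

lemma unity_sum_coprime:
  assumes "M > 0" "coprime t (int M)" "(\<Sum>a\<in>A. unity M (l * a)) = 0"
  shows "(\<Sum>a\<in>A. unity M (l * t * a)) = 0"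
proof -
  define F :: "int poly" where "F = (\<Sum>a\<in>A. monom 1 (nat (a mod int M)))"
  \<comment> \<open>Adding \<open>M\<close> makes the exponent positive.\<close>
  define s where "s = nat (t mod int M + int M)"
  have s: "int s = t mod int M + int M" using assms(1) by (simp add: s_def)
  have st: "[int s = t] (mod int M)" unfolding s by (simp add: cong_def)
  have red: "unity M (x * (a mod int M)) = unity M (x * a)" for x a
    using assms(1) by (intro unity_cong) (simp_all add: cong_def mod_mult_right_eq)
  have F: "zeval F (unity M x) = (\<Sum>a\<in>A. unity M (x * a))" for x
    using assms(1) by (simp add: F_def zeval_sum unity_power red)
  have s0: "s > 0" using assms(1) s by (metis add_nonneg_pos of_nat_0_less_iff pos_mod_sign)
  have "coprime (int s) (int M)"
    using assms(2) cong_imp_coprime[OF cong_sym[OF st]] by blast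
  then have "coprime s M" by simp
  then have "zeval F (unity M l ^ s) = 0"
    using assms s0 by (intro zeval_root_of_unity_power_coprime[where M = M])
      (auto simp: unity_power unity_eq_1_iff F)
  then have "(\<Sum>a\<in>A. unity M (l * int s * a)) = 0"
    by (simp add: unity_power F)
  moreover have "unity M (l * int s * a) = unity M (l * t * a)" for a
    using assms(1) by (intro unity_cong cong_mult st) simp_all
  ultimately show ?thesis by simp
qed

section \<open>Splitting characters modulo \<open>m * p\<close>\<close>

lemma unity_CRT:
  assumes "m > 0" "p > 0" "int p * u + int m * v = 1"
  shows "unity (m * p) x = unity m (u * x) * unity p (v * x)"
proof -
  \<comment> \<open>This is the partial fraction decomposition
    \<open>1/(m*p) = u/m + v/p\<close>.\<close>
  have "x = x * (int p * u + int m * v)" using assms(3) by simp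
  also have "\<dots> = int p * (u * x) + int m * (v * x)" by (simp add: algebra_simps)
  finally have "unity (m * p) x = unity (m * p) (int p * (u * x)) * unity (m * p) (int m * (v * x))"
    by (metis unity_add)
  moreover have "unity (m * p) (int p * (u * x)) = unity m (u * x)"
    using unity_mult_cancel[OF assms(2), of m] by (simp only: mult.commute[of m p])
  ultimately show ?thesis using unity_mult_cancel[OF assms(1), of p] by simp
qed

lemma unity_CRT_dvd:
  assumes "m > 0" "p > 0" "int p * u + int m * v = 1" "int p dvd x"
  shows "unity (m * p) x = unity m (u * x)"
proof -
  have "unity p (v * x) = 1" using assms by (simp add: unity_eq_1_iff)
  then show ?thesis using unity_CRT[OF assms(1-3)] by simp
qed

text \<open>The vanishing persists when the component modulo \<open>p\<close> of the character is replaced by any of its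
  nontrivial powers; Fourier inversion modulo \<open>p\<close> then isolates the fibres.\<close>

lemma unity_sum_fibre:
  assumes m: "m > 0" and p: "prime p" and uv: "int p * u + int m * v = 1"
    and A: "finite A" and l: "\<not> int p dvd l"
    and zero: "(\<Sum>a\<in>A. unity (m * p) (l * a)) = 0"
    and j: "j \<in> {0..<int p}"
  shows "of_nat p * (\<Sum>a | a \<in> A \<and> a mod int p = j. unity m (u * l * a)) =
           (\<Sum>a\<in>A. unity m (u * l * a))"
proof -
  have p0: "p > 0" using p prime_gt_0_nat by blast
  have pp: "prime (int p)" using p by simp
  have v: "\<not> int p dvd v"
  proof
    assume "int p dvd v"
    then have "int p dvd 1" using uv by (metis dvd_add dvd_mult dvd_triv_left)
    then show False using pp not_prime_unit by blast
  qed
  have twist: "(\<Sum>a\<in>A. unity m (u * l * a) * unity p (v * l * a * t)) = 0"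
    if t: "\<not> int p dvd t" for t
  proof -
    \<comment> \<open>\<open>s\<close> is 1 modulo \<open>m\<close> and \<open>t\<close> modulo
      \<open>p\<close>, hence coprime to \<open>m * p\<close>; scaling the frequency by
      \<open>s\<close> changes only the component modulo \<open>p\<close>.\<close>
    define s where "s = int p * u + int m * v * t"
    have sm: "[s = 1] (mod int m)"
      unfolding cong_iff_dvd_diff
      by (metis (no_types, opaque_lifting) s_def add_diff_cancel_left add_diff_eq diff_diff_eq2 dvd_diff dvd_triv_left mult.assoc uv)
    have sp: "[s = t] (mod int p)"
    proof -
      have "s - t = int p * u + int m * v * t - (int p * u + int m * v) * t"
        using uv by (simp add: s_def)
      also have "\<dots> = int p * (u - u * t)" by (simp add: algebra_simps)
      finally show ?thesis by (simp add: cong_iff_dvd_diff)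
    qed
    have "coprime s (int m)" using cong_imp_coprime[OF cong_sym[OF sm]] by simp
    moreover have "coprime t (int p)"
      using prime_imp_coprime[OF pp t] by (simp add: coprime_commute)
    then have "coprime s (int p)" using cong_imp_coprime[OF cong_sym[OF sp]] by blast
    ultimately have "coprime s (int (m * p))" by simp
    then have "(\<Sum>a\<in>A. unity (m * p) (l * s * a)) = 0"
      using m p0 zero by (intro unity_sum_coprime) auto
    moreover have "unity (m * p) (l * s * a) = unity m (u * l * a) * unity p (v * l * a * t)" for a
    proof -
      have "unity m (u * (l * s * a)) = unity m (u * l * a)"
        using cong_mult[OF cong_refl[of "u * l * a" "int m"] sm] m
        by (intro unity_cong) (simp_all add: mult_ac)
      moreover have "unity p (v * (l * s * a)) = unity p (v * l * a * t)"
        using cong_mult[OF cong_refl[of "v * l * a" "int p"] sp] p0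
        by (intro unity_cong) (simp_all add: mult_ac)
      ultimately show ?thesis by (simp add: unity_CRT[OF m p0 uv])
    qed
    ultimately show ?thesis by simp
  qed
  \<comment> \<open>Since \<open>v\<close> and \<open>l\<close> are invertible modulo
    \<open>p\<close>, summing over the characters modulo \<open>p\<close> singles out the fibre over
    \<open>j\<close>.\<close>
  have ind: "(\<Sum>t<p. unity p (v * l * (a - j) * int t)) = (if a mod int p = j then of_nat p else 0)"
    for a
  proof -
    have "int p dvd v * l * (a - j) \<longleftrightarrow> a mod int p = j"
      using pp v l j by (auto simp: prime_dvd_mult_iff mod_eq_dvd_iff[symmetric])
    then show ?thesis by (simp add: sum_unity[OF p0])
  qed
  have "of_nat p * (\<Sum>a | a \<in> A \<and> a mod int p = j. unity m (u * l * a))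
     = (\<Sum>a\<in>A. unity m (u * l * a) * (if a mod int p = j then of_nat p else 0))"
    using A by (simp add: sum_distrib_left sum.If_cases if_distrib Int_def mult.commute cong: if_cong)
  also have "\<dots> = (\<Sum>a\<in>A. \<Sum>t<p. unity m (u * l * a) * unity p (v * l * (a - j) * int t))"
    by (simp add: ind[symmetric] sum_distrib_left)
  also have "\<dots> = (\<Sum>t<p. \<Sum>a\<in>A. unity m (u * l * a) * unity p (v * l * (a - j) * int t))"
    by (rule sum.swap)
  also have "\<dots> = (\<Sum>t<p. unity p (- v * l * j * int t) *
      (\<Sum>a\<in>A. unity m (u * l * a) * unity p (v * l * a * int t)))"
  proof (intro sum.cong refl)
    fix t
    have "unity p (v * l * (a - j) * int t) = unity p (- v * l * j * int t) * unity p (v * l * a * int t)"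
      for a by (simp add: unity_add[symmetric] algebra_simps)
    then show "(\<Sum>a\<in>A. unity m (u * l * a) * unity p (v * l * (a - j) * int t)) =
       unity p (- v * l * j * int t) * (\<Sum>a\<in>A. unity m (u * l * a) * unity p (v * l * a * int t))"
      by (simp add: sum_distrib_left mult_ac)
  qed
  \<comment> \<open>By \<open>twist\<close> only the trivial character modulo \<open>p\<close>
    survives.\<close>
  also have "\<dots> = (\<Sum>t<p. if t = 0 then (\<Sum>a\<in>A. unity m (u * l * a)) else 0)"
  proof (intro sum.cong refl)
    fix t assume "t \<in> {..<p}"
    then have "t \<noteq> 0 \<Longrightarrow> \<not> int p dvd int t" by (auto dest: dvd_imp_le)
    then show "unity p (- v * l * j * int t) *
      (\<Sum>a\<in>A. unity m (u * l * a) * unity p (v * l * a * int t)) =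
      (if t = 0 then (\<Sum>a\<in>A. unity m (u * l * a)) else 0)"
      using twist[of "int t"] by auto
  qed
  also have "\<dots> = (\<Sum>a\<in>A. unity m (u * l * a))" using p0 by simp
  finally show ?thesis .
qed

section \<open>Spectral pairs\<close>

text \<open>Arbitrary integers are allowed, because the induction reads sets modulo a smaller number
  and dilates spectra out of the standard range of residues.\<close>

definition spectral_pair :: "nat \<Rightarrow> int set \<Rightarrow> int set \<Rightarrow> bool" where
  "spectral_pair m A L \<longleftrightarrow> finite A \<and> finite L \<and> card A = card L \<and>
     (\<forall>l\<in>L. \<forall>l'\<in>L. l \<noteq> l' \<longrightarrow> (\<Sum>a\<in>A. unity m ((l - l') * a)) = 0)"

text \<open>A square matrix with orthogonal rows of equal length has orthogonal columns: the squared
  moduli of the entries of the Gram matrix of the columns have the same sum as for the rows,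
  and this sum is exhausted by the diagonal.\<close>

lemma spectral_pair_sym:
  assumes "spectral_pair m A L"
  shows "spectral_pair m L A"
proof -
  define n where "n = card A"
  have fin: "finite A" "finite L" and n: "card L = n"
    and orth: "\<And>l l'. l \<in> L \<Longrightarrow> l' \<in> L \<Longrightarrow> l \<noteq> l' \<Longrightarrow> (\<Sum>a\<in>A. unity m ((l - l') * a)) = 0"
    using assms by (auto simp: spectral_pair_def n_def)
  define T where "T a b = (\<Sum>l\<in>L. unity m ((a - b) * l))" for a b
  have "(\<Sum>a\<in>A. \<Sum>b\<in>A. T a b * cnj (T a b)) =
      (\<Sum>a\<in>A. \<Sum>b\<in>A. \<Sum>l\<in>L. \<Sum>k\<in>L. unity m ((l - k) * a) * unity m ((k - l) * b))"
    by (simp add: T_def cnj_sum sum_product cnj_unity unity_add[symmetric] algebra_simps)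
  also have "\<dots> = (\<Sum>l\<in>L. \<Sum>k\<in>L. \<Sum>a\<in>A. \<Sum>b\<in>A. unity m ((l - k) * a) * unity m ((k - l) * b))"
    by (simp add: sum.swap[of _ L A])
  also have "\<dots> = (\<Sum>l\<in>L. \<Sum>k\<in>L. (\<Sum>a\<in>A. unity m ((l - k) * a)) * (\<Sum>b\<in>A. unity m ((k - l) * b)))"
    by (simp add: sum_product)
  also have "\<dots> = (\<Sum>l\<in>L. \<Sum>k\<in>L. if k = l then of_nat (n * n) else 0)"
    using orth by (intro sum.cong refl) (auto simp: n_def)
  also have "\<dots> = of_nat (n * (n * n))"
    using fin n by simp
  finally have "(\<Sum>a\<in>A. \<Sum>b\<in>A. T a b * cnj (T a b)) = of_nat (n * (n * n))" .
  moreover have "T a b * cnj (T a b) = complex_of_real ((cmod (T a b))\<^sup>2)" for a b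
    using complex_norm_square[of "T a b"] by simp
  ultimately have "complex_of_real (\<Sum>a\<in>A. \<Sum>b\<in>A. (cmod (T a b))\<^sup>2) = complex_of_real (of_nat (n * (n * n)))"
    by (simp only: of_real_sum of_real_of_nat_eq)
  then have total: "(\<Sum>a\<in>A. \<Sum>b\<in>A. (cmod (T a b))\<^sup>2) = of_nat (n * (n * n))"
    unfolding of_real_eq_iff .
  \<comment> \<open>The diagonal terms alone add up to \<open>n * (n * n)\<close>, which is the
    whole total.\<close>
  have diag: "(\<Sum>b\<in>A. (cmod (T a b))\<^sup>2) = of_nat (n * n) + (\<Sum>b\<in>A - {a}. (cmod (T a b))\<^sup>2)"
    if "a \<in> A" for a
    using fin that n by (simp add: sum.remove T_def power2_eq_square)
  have "(\<Sum>a\<in>A. \<Sum>b\<in>A - {a}. (cmod (T a b))\<^sup>2) = 0"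
    using total by (simp add: diag sum.distrib n_def)
  then have "T a b = 0" if "a \<in> A" "b \<in> A" "a \<noteq> b" for a b
    using that fin by (simp add: sum_nonneg_eq_0_iff sum_nonneg)
  then show ?thesis
    using fin n by (simp add: spectral_pair_def T_def n_def)
qed

text \<open>Dilation by \<open>u\<close> cannot merge two frequencies, since their sum would then be
  \<open>card B\<close> instead of zero.\<close>

lemma spectral_pair_scale:
  assumes B: "finite B" "B \<noteq> {}" and K: "finite K" "card B = card K"
    and zero: "\<And>l l'. l \<in> K \<Longrightarrow> l' \<in> K \<Longrightarrow> l \<noteq> l' \<Longrightarrow> (\<Sum>a\<in>B. unity m (u * (l - l') * a)) = 0"
  shows "spectral_pair m B ((\<lambda>l. u * l) ` K)"
proof -
  have "inj_on (\<lambda>l. u * l) K"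
  proof (rule inj_onI, rule ccontr)
    fix l l' assume "l \<in> K" "l' \<in> K" "u * l = u * l'" "l \<noteq> l'"
    then have "(\<Sum>a\<in>B. unity m 0) = 0"
      using zero[of l l'] by (simp add: right_diff_distrib)
    then show False using B by simp
  qed
  then show ?thesis
    using B K zero by (auto simp: spectral_pair_def card_image right_diff_distrib)
qed

lemma pigeonhole_mod:
  assumes "m > 0" "finite L" "card L > m"
  obtains l l' where "l \<in> L" "l' \<in> L" "l \<noteq> l'" "[l = l'] (mod int m)"
proof -
  have "\<not> inj_on (\<lambda>l. l mod int m) L"
  proof (rule pigeonhole)
    have "(\<lambda>l. l mod int m) ` L \<subseteq> {0..<int m}" using assms(1) by auto
    then have "card ((\<lambda>l. l mod int m) ` L) \<le> card {0..<int m}" by (intro card_mono) simp_all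
    then show "card ((\<lambda>l. l mod int m) ` L) < card L" using assms(3) by simp
  qed
  then show ?thesis using that unfolding inj_on_def cong_def by blast
qed

lemma spectral_pair_not_cong:
  assumes "spectral_pair M A L" "M > 0" "A \<noteq> {}" "l \<in> L" "l' \<in> L" "l \<noteq> l'"
  shows "\<not> int M dvd l - l'"
proof
  assume "int M dvd l - l'"
  then have "unity M ((l - l') * a) = 1" for a
    using assms(2) by (simp add: unity_eq_1_iff)
  then have "(\<Sum>a\<in>A. unity M ((l - l') * a)) = of_nat (card A)" by simp
  then show False using assms by (auto simp: spectral_pair_def)
qed

lemma dvd_mult_coprime_combination:
  fixes p m u v x :: int
  assumes "p * u + m * v = 1" "p dvd x" "m dvd x"
  shows "m * p dvd x"
proof -
  have "x = p * u * x + m * v * x" using assms(1) by (metis distrib_right mult_1)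
  moreover have "m * p dvd p * u * x" using mult_dvd_mono[OF assms(3) dvd_triv_left[of p u]] by (simp add: mult_ac)
  moreover have "m * p dvd m * v * x" using mult_dvd_mono[OF dvd_triv_left[of m v] assms(2)] by (simp add: mult_ac)
  ultimately show ?thesis by (metis dvd_add)
qed

text \<open>By pigeonhole two frequencies agree modulo \<open>m\<close>. Their difference has a
  trivial component modulo \<open>m\<close>, so the sums in the fibre identity merely count
  elements.\<close>

lemma spectral_pair_card_fibre:
  assumes m: "m > 0" and p: "prime p" and uv: "int p * u + int m * v = 1"
    and AL: "spectral_pair (m * p) A L" and ne: "A \<noteq> {}"
    and big: "card L > m" and j: "j \<in> {0..<int p}"
  shows "p * card {a \<in> A. a mod int p = j} = card A"
proof -
  have p0: "p > 0" using p prime_gt_0_nat by blast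
  have fin: "finite A" "finite L" using AL by (auto simp: spectral_pair_def)
  obtain l l' where l: "l \<in> L" "l' \<in> L" "l \<noteq> l'" "[l = l'] (mod int m)"
    using pigeonhole_mod[OF m fin(2) big] .
  have md: "int m dvd l - l'" using l by (simp add: cong_iff_dvd_diff)
  have "\<not> int (m * p) dvd l - l'"
    using spectral_pair_not_cong[OF AL _ ne l(1-3)] m p0 by simp
  then have pd: "\<not> int p dvd l - l'"
    using dvd_mult_coprime_combination[OF uv _ md] by auto
  have "unity m (u * (l - l') * a) = 1" for a
    using md m by (simp add: unity_eq_1_iff)
  then have "of_nat p * of_nat (card {a \<in> A. a mod int p = j}) = (of_nat (card A) :: complex)"
    using unity_sum_fibre[OF m p uv fin(1) pd _ j] AL l by (simp add: spectral_pair_def)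
  then show ?thesis by (metis of_nat_eq_iff of_nat_mult)
qed

text \<open>For finite non-empty \<open>A\<close> the injectivity says that every class modulo
  \<open>card A\<close> is represented exactly once.\<close>

definition complete_residues :: "nat \<Rightarrow> int set \<Rightarrow> bool" where
  "complete_residues M A \<longleftrightarrow> card A dvd M \<and> inj_on (\<lambda>a. a mod int (card A)) A"

lemma spectral_pair_step:
  assumes IH: "\<And>A L. spectral_pair m A L \<Longrightarrow> A \<noteq> {} \<Longrightarrow> complete_residues m A"
    and m: "m > 0" and p: "prime p" and mp: "m < p"
    and AL: "spectral_pair (m * p) A L" and ne: "A \<noteq> {}"
  shows "complete_residues (m * p) A"
proof -
  have p0: "p > 0" using mp by simp
  have "\<not> p dvd m" using mp m by (auto dest: dvd_imp_le)
  then have "coprime (int p) (int m)" using prime_imp_coprime[OF p] by simp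
  then obtain u v where "u * int p + v * int m = 1"
    using bezout_int by (metis coprime_iff_gcd_eq_1)
  then have uv: "int p * u + int m * v = 1" by (simp add: mult_ac)
  have fin: "finite A" "finite L" and card: "card A = card L"
    and orth: "\<And>l l'. l \<in> L \<Longrightarrow> l' \<in> L \<Longrightarrow> l \<noteq> l' \<Longrightarrow> (\<Sum>a\<in>A. unity (m * p) ((l - l') * a)) = 0"
    using AL by (auto simp: spectral_pair_def)
  define fib where "fib S j = {a \<in> S. a mod int p = j}" for S j
  note fibre = unity_sum_fibre[OF m p uv fin(1), folded fib_def]
  \<comment> \<open>Frequencies in one class modulo \<open>p\<close> differ by a character that
    factors through the residues modulo \<open>m\<close>.\<close>
  have proj: "(\<Sum>a\<in>A. unity m (u * (l - l') * a)) = 0"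
    if "l \<in> L" "l' \<in> L" "l \<noteq> l'" "int p dvd l - l'" for l l'
  proof -
    have "unity (m * p) ((l - l') * a) = unity m (u * (l - l') * a)" for a
      using unity_CRT_dvd[OF m p0 uv, of "(l - l') * a"] that(4) by (simp add: mult.assoc)
    then show ?thesis using orth[OF that(1-3)] by simp
  qed
  show ?thesis
  proof (cases "card A \<le> m")
    case True
    have "card ((\<lambda>a. a mod int p) ` A) < card {0..<int p}"
      using True mp card_image_le[OF fin(1), of "\<lambda>a. a mod int p"] by simp
    then have "\<not> {0..<int p} \<subseteq> (\<lambda>a. a mod int p) ` A"
      using card_mono[of "(\<lambda>a. a mod int p) ` A" "{0..<int p}"] fin(1) by (meson finite_imageI not_le)
    then obtain j where j: "j \<in> {0..<int p}" "j \<notin> (\<lambda>a. a mod int p) ` A"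
      by blast
    then have empty: "fib A j = {}" by (auto simp: fib_def)
    \<comment> \<open>The sum over the empty fibre is zero, so frequencies that differ modulo
      \<open>p\<close> are orthogonal modulo \<open>m\<close> as well.\<close>
    have "spectral_pair m A ((\<lambda>l. u * l) ` L)"
    proof (rule spectral_pair_scale[OF fin(1) ne fin(2) card])
      fix l l' assume l: "l \<in> L" "l' \<in> L" "l \<noteq> l'"
      show "(\<Sum>a\<in>A. unity m (u * (l - l') * a)) = 0"
      proof (cases "int p dvd l - l'")
        case False
        then show ?thesis using fibre[OF False orth[OF l] j(1)] empty by simp
      qed (use proj l in blast)
    qed
    then have "complete_residues m A" using IH ne by blast
    then show ?thesis by (auto simp: complete_residues_def)
  next
    case False
    then have big: "card A > m" "card L > m" using card by auto
    have neL: "L \<noteq> {}" using big by auto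
    define c where "c = card (fib A 0)"
    have cA: "p * card (fib A j) = card A" if "j \<in> {0..<int p}" for j
      using spectral_pair_card_fibre[OF m p uv AL ne big(2) that] by (simp add: fib_def)
    \<comment> \<open>Duality of spectral pairs exchanges the roles of \<open>A\<close> and
      \<open>L\<close>.\<close>
    have cL: "p * card (fib L j) = card L" if "j \<in> {0..<int p}" for j
      using spectral_pair_card_fibre[OF m p uv spectral_pair_sym[OF AL] neL big(1) that]
      by (simp add: fib_def)
    have N: "card A = p * c" using cA[of 0] p0 by (simp add: c_def)
    have cA': "card (fib A j) = c" and cL': "card (fib L j) = c" if "j \<in> {0..<int p}" for j
      using cA[OF that] cL[OF that] N card p0 by auto
    have "c > 0" using N big by (cases c) auto
    then have ne': "fib A j \<noteq> {}" if "j \<in> {0..<int p}" for j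
      using cA'[OF that] by (metis card.empty less_not_refl)
    text \<open>Pigeonhole: a fibre of \<open>L\<close> with an element that is unique in its class mod \<open>m\<close> uses up
      that class, and there are fewer classes than fibres.\<close>
    have "\<exists>i\<in>{0..<int p}. \<forall>l\<in>fib L i. \<exists>k\<in>L. [k = l] (mod int m) \<and> \<not> [k = l] (mod int p)"
    proof (rule ccontr)
      assume "\<not> ?thesis"
      then have "\<forall>i\<in>{0..<int p}. \<exists>l. l \<in> fib L i \<and>
          (\<forall>k\<in>L. [k = l] (mod int m) \<longrightarrow> [k = l] (mod int p))"
        by blast
      from bchoice[OF this] obtain f where f: "\<And>i. i \<in> {0..<int p} \<Longrightarrow> f i \<in> fib L i \<and>
          (\<forall>k\<in>L. [k = f i] (mod int m) \<longrightarrow> [k = f i] (mod int p))"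
        by blast
      have "inj_on (\<lambda>i. f i mod int m) {0..<int p}"
      proof (rule inj_onI)
        fix i j assume ij: "i \<in> {0..<int p}" "j \<in> {0..<int p}" "f i mod int m = f j mod int m"
        have "f i \<in> fib L i" "f j \<in> fib L j" using f ij by blast+
        then have fij: "f j \<in> L" "f i mod int p = i" "f j mod int p = j" by (simp_all add: fib_def)
        have "[f j = f i] (mod int m)" using ij(3) by (simp add: cong_def)
        then have "[f j = f i] (mod int p)" using f[OF ij(1)] fij(1) by blast
        then show "i = j" using fij(2,3) by (simp add: cong_def)
      qed
      moreover have "(\<lambda>i. f i mod int m) ` {0..<int p} \<subseteq> {0..<int m}" using m by auto
      ultimately have "card {0..<int p} \<le> card {0..<int m}" by (metis card_inj_on_le finite_atLeastLessThan_int)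
      then show False using mp by simp
    qed
    then obtain i where i: "i \<in> {0..<int p}"
      and twin: "\<And>l. l \<in> fib L i \<Longrightarrow> \<exists>k\<in>L. [k = l] (mod int m) \<and> \<not> [k = l] (mod int p)"
      by blast
    have pair: "spectral_pair m (fib A j) ((\<lambda>l. u * l) ` fib L i)" if j: "j \<in> {0..<int p}" for j
    proof (rule spectral_pair_scale)
      show "finite (fib A j)" "finite (fib L i)" using fin by (auto simp: fib_def)
      show "fib A j \<noteq> {}" using ne'[OF j] .
      show "card (fib A j) = card (fib L i)" using cA'[OF j] cL'[OF i] by simp
      fix l l' assume l: "l \<in> fib L i" "l' \<in> fib L i" "l \<noteq> l'"
      then have lp: "[l = l'] (mod int p)" and lL: "l \<in> L" "l' \<in> L" by (auto simp: fib_def cong_def)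
      \<comment> \<open>The twin \<open>k\<close> stands in for \<open>l\<close>: modulo
        \<open>m\<close> nothing changes, but \<open>k - l'\<close> is prime to \<open>p\<close>.
        The fibre identity thus passes from the full sum, which is zero by \<open>proj\<close>, to
        each fibre.\<close>
      obtain k where k: "k \<in> L" "[k = l] (mod int m)" "\<not> [k = l] (mod int p)"
        using twin[OF l(1)] by blast
      have kl': "\<not> [k = l'] (mod int p)" using k(3) lp by (metis cong_sym cong_trans)
      then have kl: "\<not> int p dvd k - l'" "k \<noteq> l'" by (auto simp: cong_iff_dvd_diff)
      have eq: "unity m (u * (k - l') * a) = unity m (u * (l - l') * a)" for a
        using m k(2) by (intro unity_cong cong_mult cong_diff cong_refl) simp_all
      have "(\<Sum>a\<in>A. unity m (u * (l - l') * a)) = 0"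
        using proj[OF lL l(3)] lp by (simp add: cong_iff_dvd_diff)
      then show "(\<Sum>a\<in>fib A j. unity m (u * (l - l') * a)) = 0"
        using fibre[OF kl(1) orth[OF k(1) lL(2) kl(2)] j] p0 by (simp add: eq)
    qed
    have compl: "complete_residues m (fib A j)" if "j \<in> {0..<int p}" for j
      using IH[OF pair[OF that] ne'[OF that]] .
    have "c dvd m" using compl[of 0] cA'[of 0] p0 by (simp add: complete_residues_def)
    moreover have "inj_on (\<lambda>a. a mod int (card A)) A"
    proof (rule inj_onI)
      fix a b assume ab: "a \<in> A" "b \<in> A" "a mod int (card A) = b mod int (card A)"
      \<comment> \<open>Divisibility by \<open>p * c\<close> puts \<open>a\<close> and
        \<open>b\<close> into the same fibre and into the same class modulo its size
        \<open>c\<close>.\<close>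
      then have d: "int p * int c dvd a - b" by (simp add: N mod_eq_dvd_iff)
      define j where "j = a mod int p"
      have j: "j \<in> {0..<int p}" using p0 by (simp add: j_def)
      have "a mod int p = b mod int p" "a mod int c = b mod int c"
        unfolding mod_eq_dvd_iff by (rule dvd_mult_left[OF d], rule dvd_mult_right[OF d])
      then have "a \<in> fib A j" "b \<in> fib A j" "a mod int (card (fib A j)) = b mod int (card (fib A j))"
        using ab cA'[OF j] by (auto simp: fib_def j_def)
      then show "a = b" using compl[OF j] by (auto simp: complete_residues_def dest: inj_onD)
    qed
    ultimately show ?thesis by (simp add: complete_residues_def N)
  qed
qed

lemma spectral_pair_complete_residues:
  fixes p :: "nat \<Rightarrow> nat"
  assumes "\<And>i. i \<in> {1..k} \<Longrightarrow> prime (p i)"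
    and "\<And>j. j \<in> {1..<k} \<Longrightarrow> p (j + 1) > (\<Prod>i=1..j. p i)"
    and "spectral_pair (\<Prod>i=1..k. p i) A L" "A \<noteq> {}"
  shows "complete_residues (\<Prod>i=1..k. p i) A"
  using assms
proof (induction k arbitrary: A L)
  case 0
  \<comment> \<open>Modulo the empty product 1 all integers are congruent, so no two frequencies are
    orthogonal.\<close>
  have "card L \<le> 1"
  proof (rule ccontr)
    assume "\<not> card L \<le> 1"
    then obtain l l' where "l \<in> L" "l' \<in> L" "l \<noteq> l'"
      by (metis card_le_Suc0_iff_eq card.infinite One_nat_def zero_le_one)
    then show False using spectral_pair_not_cong[OF 0(3) _ 0(4)] by simp
  qed
  then have "card A = 1"
    using 0 by (metis One_nat_def card_0_eq le_Suc_eq le_zero_eq spectral_pair_def)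
  then show ?case by (auto simp: complete_residues_def card_1_singleton_iff)
next
  case (Suc k)
  have prod: "(\<Prod>i=1..Suc k. p i) = (\<Prod>i=1..k. p i) * p (Suc k)" by simp
  \<comment> \<open>For \<open>k = 0\<close> the left side is the empty product 1, which is below
    every prime.\<close>
  have less: "(\<Prod>i=1..k. p i) < p (Suc k)"
  proof (cases "k = 0")
    case True
    then show ?thesis using Suc.prems(1)[of 1] prime_gt_1_nat[of "p 1"] by simp
  next
    case False
    then show ?thesis using Suc.prems(2)[of k] by simp
  qed
  show ?case unfolding prod
  proof (rule spectral_pair_step)
    show "complete_residues (\<Prod>i=1..k. p i) B" if "spectral_pair (\<Prod>i=1..k. p i) B K" "B \<noteq> {}" for B K
      using that Suc.prems(1,2) by (intro Suc.IH[of B K]) auto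
    show "0 < (\<Prod>i=1..k. p i)"
      using Suc.prems(1) by (intro prod_pos) (auto intro: prime_gt_0_nat)
    show "spectral_pair ((\<Prod>i=1..k. p i) * p (Suc k)) A L" using Suc.prems(3) prod by simp
  qed (use Suc.prems less in auto)
qed

section \<open>Dilations of tilings\<close>

text \<open>For \<open>x < M\<close> this is the coefficient of \<open>X^x\<close> after reduction
  modulo \<open>X^M - 1\<close>.\<close>

definition residue_coeff :: "nat \<Rightarrow> nat \<Rightarrow> int poly \<Rightarrow> int" where
  "residue_coeff M x P = (\<Sum>i\<le>degree P. if i mod M = x then coeff P i else 0)"

text \<open>This lets polynomials of different degrees share one summation range.\<close>

lemma residue_coeff_eq:
  assumes "degree P \<le> n"
  shows "residue_coeff M x P = (\<Sum>i\<le>n. if i mod M = x then coeff P i else 0)"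
  unfolding residue_coeff_def using assms
  by (intro sum.mono_neutral_left) (auto intro: coeff_eq_0)

lemma residue_coeff_add: "residue_coeff M x (P + Q) = residue_coeff M x P + residue_coeff M x Q"
proof -
  define n where "n = max (degree P) (degree Q)"
  have "degree P \<le> n" "degree Q \<le> n" "degree (P + Q) \<le> n"
    by (auto simp: n_def degree_add_le)
  note * = this[THEN residue_coeff_eq, of M x]
  show ?thesis unfolding * sum.distrib[symmetric] by (intro sum.cong) auto
qed

lemma residue_coeff_smult: "residue_coeff M x (smult c P) = c * residue_coeff M x P"
  by (subst residue_coeff_eq[OF degree_smult_le])
    (auto simp: residue_coeff_def sum_distrib_left intro!: sum.cong)

lemma residue_coeff_0 [simp]: "residue_coeff M x 0 = 0"
  using residue_coeff_smult[of M x 0 0] by simp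

lemma residue_coeff_sum:
  "residue_coeff M x (sum P A) = (\<Sum>a\<in>A. residue_coeff M x (P a))"
  by (induction A rule: infinite_finite_induct)
    (simp_all add: residue_coeff_add)

lemma residue_coeff_monom:
  "residue_coeff M x (monom c n) = (if n mod M = x then c else 0)"
proof -
  have "residue_coeff M x (monom c n) = (\<Sum>i\<le>n. if i = n then (if n mod M = x then c else 0) else 0)"
    unfolding residue_coeff_eq[OF degree_monom_le] by (intro sum.cong) auto
  then show ?thesis by simp
qed

text \<open>Translation by \<open>n\<close> permutes the residues modulo \<open>M\<close>, so
  exactly one \<open>y\<close> contributes.\<close>

lemma sum_add_mod_eq:
  fixes c :: int and x M :: nat
  assumes "x < M"
  shows "(\<Sum>y<M. if (y + n) mod M = x then c else 0) = c"
proof -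
  have "inj_on (\<lambda>y. (y + n) mod M) {..<M}"
  proof (rule inj_onI)
    fix y z assume yz: "y \<in> {..<M}" "z \<in> {..<M}" "(y + n) mod M = (z + n) mod M"
    then have "[y = z] (mod M)" by (metis cong_def cong_add_rcancel_nat)
    then show "y = z" using yz by (simp add: cong_def)
  qed
  moreover have "(\<lambda>y. (y + n) mod M) ` {..<M} \<subseteq> {..<M}" using assms by auto
  ultimately have "bij_betw (\<lambda>y. (y + n) mod M) {..<M} {..<M}"
    by (simp add: bij_betw_def endo_inj_surj)
  then have "(\<Sum>y<M. if (y + n) mod M = x then c else 0) = (\<Sum>z<M. if z = x then c else 0)"
    by (rule sum.reindex_bij_betw)
  then show ?thesis using assms by simp
qed

text \<open>Count modulo \<open>r\<close> the representations of \<open>x\<close> as \<open>f a\<^sub>1 + \<dots> + f a\<^sub>r + g b\<close>. There are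
  \<open>(card A) ^ (r - 1)\<close> of them, which is not divisible by \<open>r\<close>, while by \<open>P(X)\<^sup>r = P(X\<^sup>r)\<close> modulo \<open>r\<close>
  only those with equal \<open>a\<^sub>i\<close> matter.\<close>

lemma tiling_dilate_prime:
  fixes f :: "'a \<Rightarrow> nat" and g :: "'b \<Rightarrow> nat"
  assumes fin: "finite A" "finite B" and M: "card A * card B = M"
    and surj: "{..<M} \<subseteq> (\<lambda>(a, b). (f a + g b) mod M) ` (A \<times> B)"
    and r: "prime r" "\<not> r dvd card A"
  shows "{..<M} \<subseteq> (\<lambda>(a, b). (r * f a + g b) mod M) ` (A \<times> B)"
proof
  fix x assume x: "x \<in> {..<M}"
  define P :: "int poly" where "P = (\<Sum>a\<in>A. monom 1 (f a))"
  define Q :: "int poly" where "Q = (\<Sum>b\<in>B. monom 1 (g b))"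
  let ?\<phi> = "\<lambda>(a, b). (f a + g b) mod M"
  have M0: "M > 0" using x by auto
  have "?\<phi> ` (A \<times> B) = {..<M}" using surj M0 by auto
  moreover have "card (A \<times> B) = card {..<M}" using M by (simp add: card_cartesian_product)
  ultimately have bij: "bij_betw ?\<phi> (A \<times> B) {..<M}"
    using fin by (simp add: bij_betw_def eq_card_imp_inj_on)
  have mono: "residue_coeff M x (P * Q * monom c n) = c" for c n
  proof -
    have "P * Q = (\<Sum>(a, b)\<in>A \<times> B. monom 1 (f a + g b))"
      by (simp add: P_def Q_def sum_product mult_monom sum.cartesian_product)
    then have "P * Q * monom c n = (\<Sum>(a, b)\<in>A \<times> B. monom c (f a + g b + n))"
      by (simp add: sum_distrib_right mult_monom case_prod_unfold)
    then have "residue_coeff M x (P * Q * monom c n) =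
        (\<Sum>ab\<in>A \<times> B. if (?\<phi> ab + n) mod M = x then c else 0)"
      by (simp add: residue_coeff_sum residue_coeff_monom case_prod_unfold mod_add_left_eq)
    also have "\<dots> = (\<Sum>y<M. if (y + n) mod M = x then c else 0)"
      by (rule sum.reindex_bij_betw[OF bij])
    finally show ?thesis using x by (simp add: sum_add_mod_eq)
  qed
  \<comment> \<open>The tiling makes \<open>P * Q\<close> equal to
    \<open>1 + X + ... + X^(M-1)\<close> modulo \<open>X^M - 1\<close>; multiplying by
    \<open>R\<close> then puts \<open>R(1)\<close> into every residue class.\<close>
  have all: "residue_coeff M x (P * Q * R) = poly R 1" for R
  proof -
    have "P * Q * R = (\<Sum>i\<le>degree R. P * Q * monom (coeff R i) i)"
      by (simp only: sum_distrib_left[symmetric] poly_as_sum_of_monoms)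
    then show ?thesis by (simp add: residue_coeff_sum mono poly_altdef)
  qed
  have r0: "r > 0" using r prime_gt_0_nat by blast
  obtain K where "P ^ r - pcompose P (monom 1 r) = of_nat r * K"
    using prime_dvd_poly_power_diff_pcompose[OF r(1), of P] by (elim dvdE)
  then have "P ^ r = pcompose P (monom 1 r) + smult (int r) K"
    by (simp add: of_nat_poly algebra_simps)
  moreover have "P * Q * P ^ (r - 1) = P ^ r * Q"
    using power_minus_mult[OF r0, of P] by (simp add: mult_ac)
  ultimately have "P * Q * P ^ (r - 1) = pcompose P (monom 1 r) * Q + smult (int r) (K * Q)"
    by (simp add: distrib_right)
  then have "int (card A) ^ (r - 1) =
      residue_coeff M x (pcompose P (monom 1 r) * Q) + int r * residue_coeff M x (K * Q)"
    using all[of "P ^ (r - 1)"]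
    by (simp add: residue_coeff_add residue_coeff_smult poly_power P_def poly_sum poly_monom)
  moreover have "\<not> int r dvd int (card A) ^ (r - 1)"
    using r prime_dvd_power[of "int r" "int (card A)" "r - 1"] by auto
  ultimately have ne: "residue_coeff M x (pcompose P (monom 1 r) * Q) \<noteq> 0"
    by auto
  have "pcompose (monom 1 n) (monom 1 r) = (monom 1 (r * n) :: int poly)" for n
    by (induction n) (simp_all add: monom_Suc monom_0 pcompose_pCons mult_monom)
  then have "pcompose P (monom 1 r) * Q = (\<Sum>(a, b)\<in>A \<times> B. monom 1 (r * f a + g b))"
    by (simp add: P_def Q_def pcompose_sum sum_product mult_monom sum.cartesian_product)
  then have *: "residue_coeff M x (pcompose P (monom 1 r) * Q) =
      (\<Sum>ab\<in>A \<times> B. if (r * f (fst ab) + g (snd ab)) mod M = x then 1 else 0)"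
    by (simp add: residue_coeff_sum residue_coeff_monom case_prod_unfold)
  show "x \<in> (\<lambda>(a, b). (r * f a + g b) mod M) ` (A \<times> B)"
  proof (rule ccontr)
    assume "x \<notin> (\<lambda>(a, b). (r * f a + g b) mod M) ` (A \<times> B)"
    then have "(r * f (fst ab) + g (snd ab)) mod M \<noteq> x" if "ab \<in> A \<times> B" for ab
      using that unfolding case_prod_unfold by blast
    then show False using ne unfolding * by (simp add: sum.neutral)
  qed
qed

text \<open>The multiplier is built up prime by prime. Each factor is absorbed into
  \<open>f\<close>, which is why tilings are given here by functions and not by sets of
  residues.\<close>

lemma tiling_dilate:
  fixes f :: "'a \<Rightarrow> nat" and g :: "'b \<Rightarrow> nat"
  assumes "finite A" "finite B" "card A * card B = M"
    and "{..<M} \<subseteq> (\<lambda>(a, b). (f a + g b) mod M) ` (A \<times> B)"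
    and "coprime n (card A)" "n > 0"
  shows "{..<M} \<subseteq> (\<lambda>(a, b). (n * f a + g b) mod M) ` (A \<times> B)"
  using assms
proof (induction n arbitrary: f rule: prime_divisors_induct)
  case (factor p n)
  have "\<not> p dvd card A"
    using factor.prems factor.hyps
    by (metis coprime_common_divisor dvd_triv_left not_prime_unit)
  then have "{..<M} \<subseteq> (\<lambda>(a, b). (p * f a + g b) mod M) ` (A \<times> B)"
    using factor.prems factor.hyps by (intro tiling_dilate_prime) auto
  then have "{..<M} \<subseteq> (\<lambda>(a, b). (n * (p * f a) + g b) mod M) ` (A \<times> B)"
    using factor.prems by (intro factor.IH) auto
  then show ?case by (simp add: mult_ac)
qed auto

section \<open>Tilings and spectra of sets of residues\<close>

lemma tiles_imp_complete_residues:
  assumes sf: "squarefree M" and tl: "tiles M A"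
  shows "complete_residues M A"
proof -
  have M0: "M > 0" using sf by (cases M) auto
  then have car: "carrier (integer_mod_group M) = {0..<int M}"
    by (simp add: carrier_integer_mod_group)
  obtain B where A: "A \<subseteq> {0..<int M}" and B: "B \<subseteq> {0..<int M}"
    and ex1: "\<And>x. x \<in> {0..<int M} \<Longrightarrow> \<exists>!ab. ab \<in> A \<times> B \<and> x = (fst ab + snd ab) mod int M"
    using tl unfolding tiles_def car by auto
  have fin: "finite A" "finite B" using A B finite_subset by blast+
  let ?\<phi> = "\<lambda>ab. (fst ab + snd ab) mod int M"
  have "inj_on ?\<phi> (A \<times> B)"
  proof (rule inj_onI)
    fix s t assume st: "s \<in> A \<times> B" "t \<in> A \<times> B" "?\<phi> s = ?\<phi> t"
    have "?\<phi> s \<in> {0..<int M}" using M0 by simp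
    from ex1[OF this] show "s = t" using st by blast
  qed
  moreover have im: "?\<phi> ` (A \<times> B) = {0..<int M}"
  proof
    show "?\<phi> ` (A \<times> B) \<subseteq> {0..<int M}" using M0 by auto
    show "{0..<int M} \<subseteq> ?\<phi> ` (A \<times> B)"
    proof
      fix x assume "x \<in> {0..<int M}"
      from ex1[OF this] show "x \<in> ?\<phi> ` (A \<times> B)" by blast
    qed
  qed
  ultimately have "card (A \<times> B) = card {0..<int M}" by (metis card_image)
  then have card: "card A * card B = M" by (simp add: card_cartesian_product)
  \<comment> \<open>The square of the gcd divides the squarefree number \<open>M\<close>.\<close>
  have cop: "coprime (card B) (card A)"
  proof -
    have "(gcd (card B) (card A))\<^sup>2 dvd card A * card B"
      by (simp add: power2_eq_square mult_dvd_mono)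
    then have "is_unit (gcd (card B) (card A))"
      using sf card by (simp add: squarefree_def)
    then show ?thesis by (simp add: coprime_iff_gcd_eq_1)
  qed
  have B0: "card B > 0" using card M0 by (cases "card B") auto
  have "{..<M} \<subseteq> (\<lambda>(a, b). (nat a + nat b) mod M) ` (A \<times> B)"
  proof
    fix x assume "x \<in> {..<M}"
    then have "int x \<in> ?\<phi> ` (A \<times> B)" unfolding im by simp
    then obtain a b where ab: "a \<in> A" "b \<in> B" "int x = (a + b) mod int M" by auto
    then have "int x = int ((nat a + nat b) mod M)"
      using A B by (auto simp: zmod_int subset_eq)
    then show "x \<in> (\<lambda>(a, b). (nat a + nat b) mod M) ` (A \<times> B)" using ab by force
  qed
  \<comment> \<open>The multiplier \<open>card B\<close> turns congruence modulo
    \<open>card A\<close> into congruence modulo \<open>M = card A * card B\<close>, where the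
    dilated tiling separates elements.\<close>
  then have sub: "{..<M} \<subseteq> (\<lambda>(a, b). (card B * nat a + nat b) mod M) ` (A \<times> B)"
    (is "_ \<subseteq> ?\<psi> ` _")
    using fin card cop B0 by (intro tiling_dilate) auto
  then have "?\<psi> ` (A \<times> B) = {..<M}" using M0 by auto
  then have inj: "inj_on ?\<psi> (A \<times> B)"
    using fin card by (intro eq_card_imp_inj_on) (auto simp: card_cartesian_product)
  obtain b where b: "b \<in> B" using B0 by (metis card_gt_0_iff ex_in_conv)
  have "inj_on (\<lambda>a. a mod int (card A)) A"
  proof (rule inj_onI)
    fix a a' assume a: "a \<in> A" "a' \<in> A" "a mod int (card A) = a' mod int (card A)"
    then have "int (card A) dvd a - a'" by (simp add: mod_eq_dvd_iff)
    then have "int (card A) * int (card B) dvd (a - a') * int (card B)"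
      by (rule mult_dvd_mono) simp
    moreover have "(a - a') * int (card B) =
        int (card B * nat a + nat b) - int (card B * nat a' + nat b)"
      using a A by (auto simp: subset_eq algebra_simps)
    ultimately have "[int (card B * nat a + nat b) = int (card B * nat a' + nat b)] (mod int M)"
      unfolding cong_iff_dvd_diff by (metis card of_nat_mult)
    then have "?\<psi> (a, b) = ?\<psi> (a', b)"
      unfolding cong_int_iff by (simp add: cong_def)
    then show "a = a'" using inj_onD[OF inj, of "(a, b)" "(a', b)"] a b by auto
  qed
  then show ?thesis using card by (auto simp: complete_residues_def)
qed

section \<open>Constructing tilings and spectra\<close>

lemma complete_residues_bij_betw:
  assumes "complete_residues M A" "M > 0"
  shows "bij_betw (\<lambda>a. a mod int (card A)) A {0..<int (card A)}"
proof -
  have "card A > 0" using assms by (auto simp: complete_residues_def intro: gr0I)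
  then have "(\<lambda>a. a mod int (card A)) ` A \<subseteq> {0..<int (card A)}" by auto
  moreover have inj: "inj_on (\<lambda>a. a mod int (card A)) A"
    using assms by (simp add: complete_residues_def)
  ultimately show ?thesis
    by (simp add: bij_betw_def card_image card_subset_eq)
qed

text \<open>The multiples of \<open>card A\<close> form the tiling complement: the class of
  \<open>x\<close> modulo \<open>card A\<close> determines \<open>a\<close>, and then
  \<open>b\<close> is determined modulo \<open>M\<close>.\<close>

lemma complete_residues_imp_tiles:
  assumes A: "A \<subseteq> {0..<int M}" and M0: "M > 0" and compl: "complete_residues M A"
  shows "tiles M A"
proof -
  define N where "N = int (card A)"
  have NM: "N dvd int M" using compl by (auto simp: complete_residues_def N_def)
  define B where "B = {b \<in> {0..<int M}. N dvd b}"
  have car: "carrier (integer_mod_group M) = {0..<int M}"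
    using M0 by (simp add: carrier_integer_mod_group)
  have N0: "N > 0" using compl M0 by (auto simp: complete_residues_def N_def intro: gr0I)
  have bij: "bij_betw (\<lambda>a. a mod N) A {0..<N}"
    using complete_residues_bij_betw[OF compl M0] by (simp add: N_def)
  have "\<exists>!ab. ab \<in> A \<times> B \<and> x = (fst ab + snd ab) mod int M" if x: "x \<in> {0..<int M}" for x
  proof -
    have "x mod N \<in> (\<lambda>a. a mod N) ` A"
      using bij N0 by (simp add: bij_betw_def)
    then obtain a where a: "a \<in> A" "a mod N = x mod N" by auto
    define b where "b = (x - a) mod int M"
    have "N dvd x - a" using a(2) by (metis mod_eq_dvd_iff)
    then have b: "b \<in> B" using NM M0 by (simp add: B_def b_def dvd_mod)
    show ?thesis
    proof (rule ex1I[of _ "(a, b)"])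
      show "(a, b) \<in> A \<times> B \<and> x = (fst (a, b) + snd (a, b)) mod int M"
        using a b x by (simp add: b_def mod_add_right_eq)
    next
      fix t assume t: "t \<in> A \<times> B \<and> x = (fst t + snd t) mod int M"
      then have tA: "fst t \<in> A" and tB: "N dvd snd t" "snd t \<in> {0..<int M}"
        by (auto simp: B_def)
      have "int M dvd fst t + snd t - x"
        using t x by (metis mod_eq_dvd_iff mod_mod_trivial)
      then have "N dvd fst t + snd t - x - snd t" using NM tB by (meson dvd_diff dvd_trans)
      then have "fst t mod N = x mod N" by (simp add: mod_eq_dvd_iff)
      then have "fst t = a"
        using inj_onD[OF bij_betw_imp_inj_on[OF bij], of "fst t" a] tA a by simp
      moreover have "snd t = b"
      proof -
        have "b = ((fst t + snd t) mod int M - a) mod int M" using t by (simp add: b_def)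
        also have "\<dots> = snd t mod int M"
          unfolding mod_diff_left_eq using \<open>fst t = a\<close> by simp
        finally show ?thesis using tB by simp
      qed
      ultimately show "t = (a, b)" by (simp add: prod_eq_iff)
    qed
  qed
  moreover have "B \<subseteq> {0..<int M}" by (auto simp: B_def)
  ultimately show ?thesis
    unfolding tiles_def car mult_integer_mod_group using A by blast
qed

lemma exp_eq_unity:
  "exp (2 * complex_of_real pi * \<i> * of_int x * of_int a / of_nat M) = unity M (x * a)"
  by (simp add: unity_def cis_conv_exp mult_ac)

text \<open>The multiples of \<open>K = M / card A\<close> form a spectrum: their characters factor
  through the residues modulo \<open>card A\<close>, each of which \<open>A\<close> meets
  once.\<close>

lemma complete_residues_imp_spectral:
  assumes A: "A \<subseteq> {0..<int M}" and M0: "M > 0" and compl: "complete_residues M A"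
  shows "spectral M A"
proof -
  define N where "N = card A"
  obtain K where K: "M = K * N"
    using compl by (metis complete_residues_def N_def dvdE mult.commute)
  have N0: "N > 0" and K0: "K > 0" using K M0 by (auto intro: gr0I)
  have car: "carrier (integer_mod_group M) = {0..<int M}"
    using M0 by (simp add: carrier_integer_mod_group)
  define L where "L = (\<lambda>j. int K * j) ` {0..<int N}"
  have "inj_on (\<lambda>j. int K * j) {0..<int N}" using K0 by (auto intro: inj_onI)
  then have cL: "card L = card A" by (simp add: L_def card_image N_def)
  have LM: "L \<subseteq> {0..<int M}" using K0 by (auto simp: L_def K)
  have zero: "(\<Sum>a\<in>A. unity M ((l - l') * a)) = 0" if l: "l \<in> L" "l' \<in> L" "l \<noteq> l'" for l l'
  proof -
    obtain j j' where j: "l = int K * j" "l' = int K * j'" "j \<in> {0..<int N}" "j' \<in> {0..<int N}"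
      using l by (auto simp: L_def)
    define d where "d = j - j'"
    have d: "\<not> int N dvd d"
    proof
      assume "int N dvd d"
      then have "j mod int N = j' mod int N" by (simp add: d_def mod_eq_dvd_iff)
      then show False using j l by simp
    qed
    have red: "unity N (d * (a mod int N)) = unity N (d * a)" for a
      using N0 by (intro unity_cong) (simp_all add: cong_def mod_mult_right_eq)
    have "unity M ((l - l') * a) = unity N (d * a)" for a
      using unity_mult_cancel[OF K0, of N "d * a"] by (simp add: j d_def K algebra_simps)
    then have "(\<Sum>a\<in>A. unity M ((l - l') * a)) = (\<Sum>a\<in>A. unity N (d * (a mod int N)))"
      by (simp add: red)
    also have "\<dots> = (\<Sum>y\<in>{0..<int N}. unity N (d * y))"
      by (rule sum.reindex_bij_betw[OF complete_residues_bij_betw[OF compl M0, folded N_def]])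
    also have "\<dots> = (\<Sum>t<N. unity N (d * int t))"
      by (rule sum.reindex_bij_witness[of _ int nat]) auto
    also have "\<dots> = 0" using d by (simp add: sum_unity[OF N0])
    finally show ?thesis .
  qed
  have "A \<noteq> {}" using N0 by (auto simp: N_def)
  then show ?thesis
    unfolding spectral_def car exp_eq_unity using A LM cL zero by (auto intro!: exI[of _ L])
qed

theorem theorem1p2:
  fixes k M :: nat and p :: "nat \<Rightarrow> nat"
  assumes "\<And>i. i \<in> {1..k} \<Longrightarrow> prime (p i)"
    and "inj_on p {1..k}"
    and "M = (\<Prod>i=1..k. p i)"
    and "\<And>j. j \<in> {1..<k} \<Longrightarrow> p (j + 1) > (\<Prod>i=1..j. p i)"
  shows "\<forall>A. A \<subseteq> carrier (integer_mod_group M) \<and> A \<noteq> {} \<longrightarrow> (spectral M A \<longleftrightarrow> tiles M A)"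
proof (intro allI impI, elim conjE)
  fix A assume A: "A \<subseteq> carrier (integer_mod_group M)" and ne: "A \<noteq> {}"
  have sf: "squarefree M" unfolding assms(3)
  proof (rule squarefree_prod_coprime)
    show "coprime (p i) (p j)" if "i \<in> {1..k}" "j \<in> {1..k}" "i \<noteq> j" for i j
      using that assms(1,2) by (auto intro!: primes_coprime dest: inj_onD)
    show "squarefree (p i)" if "i \<in> {1..k}" for i
      using that assms(1) by (intro squarefree_prime) auto
  qed
  then have M0: "M > 0" by (cases M) auto
  then have car: "carrier (integer_mod_group M) = {0..<int M}"
    by (simp add: carrier_integer_mod_group)
  have A': "A \<subseteq> {0..<int M}" using A by (simp add: car)
  show "spectral M A \<longleftrightarrow> tiles M A"
  proof
    assume "spectral M A"
    then obtain L where "L \<subseteq> {0..<int M} \<and> card L = card A \<and>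
        (\<forall>l\<in>L. \<forall>l'\<in>L. l \<noteq> l' \<longrightarrow> (\<Sum>a\<in>A. unity M ((l - l') * a)) = 0)"
      unfolding spectral_def exp_eq_unity car by blast
    then have "spectral_pair M A L"
      using A' by (auto simp: spectral_pair_def intro: finite_subset)
    then have "complete_residues M A"
      using spectral_pair_complete_residues[of k p A L] assms ne by simp
    then show "tiles M A" by (rule complete_residues_imp_tiles[OF A' M0])
  next
    assume "tiles M A"
    then have "complete_residues M A" by (rule tiles_imp_complete_residues[OF sf])
    then show "spectral M A" by (rule complete_residues_imp_spectral[OF A' M0])
  qed
qed

end
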